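(* Let $n,m\ge 1$ be integers and $V(n,m)=\{1,\dots,n\}\times\{1,\dots,m\}$. The minimum number of edges of a (possibly self-crossing) geometric tree covering $V(n,m)$ is $2\min(n,m)-2$ if $n=m\ge 3$, and $2\min(n,m)-1$ otherwise. The minimum number of edges of a noncrossing geometric tree covering $V(n,m)$ is $2\min(n,m)-1$ for all $n,m\ge 1$.
   Context: A geometric tree is a finite abstract tree with at least one edge whose vertices are distinct points of the plane (arbitrary points, not necessarily in $V(n,m)$) and whose edges are drawn as the closed straight-line segments between their endpoints. It covers a point set $P$ if every point of $P$ lies on the union of its edges. It is noncrossing if any two edges intersect only if they share an endpoint, and then only in that endpoint. *)

theory Defs
  imports "HOL-Analysis.Analysis"
begin

type_synonym point = "real \<times> real"

definition adj :: "point set set \<Rightarrow> point \<Rightarrow> point \<Rightarrow> bool" where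
  "adj E u v \<longleftrightarrow> {u, v} \<in> E"

definition graph_connected :: "point set \<Rightarrow> point set set \<Rightarrow> bool" where
  "graph_connected V E \<longleftrightarrow>
     (\<forall>u\<in>V. \<forall>v\<in>V. (u, v) \<in> (rtrancl {(x, y). adj E x y}))"

definition is_cycle :: "point set set \<Rightarrow> point list \<Rightarrow> bool" where
  "is_cycle E cs \<longleftrightarrow> length cs \<ge> 3 \<and> distinct cs \<and>
     (\<forall>i < length cs - 1. adj E (cs ! i) (cs ! Suc i)) \<and>
     adj E (last cs) (hd cs)"

definition is_tree :: "point set \<Rightarrow> point set set \<Rightarrow> bool" where
  "is_tree V E \<longleftrightarrow> finite V \<and>
     (\<forall>e\<in>E. \<exists>u v. u \<in> V \<and> v \<in> V \<and> u \<noteq> v \<and> e = {u, v}) \<and>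
     graph_connected V E \<and> \<not> (\<exists>cs. is_cycle E cs)"

definition geometric_tree :: "point set \<Rightarrow> point set set \<Rightarrow> bool" where
  "geometric_tree V E \<longleftrightarrow> is_tree V E \<and> E \<noteq> {}"

definition edge_seg :: "point set \<Rightarrow> point set" where
  "edge_seg e = convex hull e"

definition covers :: "point set set \<Rightarrow> point set \<Rightarrow> bool" where
  "covers E P \<longleftrightarrow> P \<subseteq> (\<Union>e\<in>E. edge_seg e)"

definition noncrossing :: "point set set \<Rightarrow> bool" where
  "noncrossing E \<longleftrightarrow>
     (\<forall>e1\<in>E. \<forall>e2\<in>E. e1 \<noteq> e2 \<longrightarrow> edge_seg e1 \<inter> edge_seg e2 \<noteq> {} \<longrightarrow>
        (\<exists>p. p \<in> e1 \<inter> e2 \<and> edge_seg e1 \<inter> edge_seg e2 = {p}))"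

definition grid :: "nat \<Rightarrow> nat \<Rightarrow> point set" where
  "grid n m = {(real i, real j) | i j. 1 \<le> i \<and> i \<le> n \<and> 1 \<le> j \<and> j \<le> m}"

definition is_minimum :: "nat set \<Rightarrow> nat \<Rightarrow> bool" where
  "is_minimum S k \<longleftrightarrow> k \<in> S \<and> (\<forall>x\<in>S. k \<le> x)"

end

theory Submission
  imports Defs
begin

text \<open>
  Lower bound. Call a row or column free if no edge lies along it. Without free rows there are \<open>m\<close>
  horizontal edges, and as the tree is connected, contracting these leaves at least \<open>m - 1\<close> others.
  Otherwise the skew edges alone cover the product of the \<open>a\<close> free rows and \<open>b\<close> free columns. If
  \<open>a, b \<ge> 2\<close>, then each of them meets the frame of this product, which has \<open>2a + 2b - 4\<close> points, at
  most twice; so there are at least \<open>a + b - 2\<close> of them and \<open>n + m - 2\<close> edges in total. Equality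
  forces two skew edges to cross properly, which is impossible in a noncrossing tree, and impossible
  for \<open>n = m = 2\<close>, where these two edges would be the whole tree.

  Upper bound. A comb is a noncrossing tree. For \<open>n = m \<ge> 3\<close>, the solution of the nine dots puzzle
  with four edges is continued as a spiral, two edges for each additional row and column.
\<close>

subsection \<open>Edges of a tree and level sets\<close>

lemma tree_edgeE:
  assumes "is_tree V E" "e \<in> E"
  obtains u v where "u \<in> V" "v \<in> V" "u \<noteq> v" "e = {u, v}"
  using assms unfolding is_tree_def by meson

lemma tree_edges_finite:
  assumes "is_tree V E"
  shows "finite E"
proof (rule finite_subset)
  show "E \<subseteq> Pow V" using tree_edgeE[OF assms] by blast
  show "finite (Pow V)" using assms by (simp add: is_tree_def)
qed

lemma edge_seg_doubleton: "edge_seg {u, v} = closed_segment u v"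
  by (simp add: edge_seg_def segment_convex_hull)

text \<open>A walk from \<open>u\<close> to \<open>v\<close> has to leave \<open>W\<close> at some
  step.\<close>

lemma edge_crossing_cut:
  assumes "graph_connected V E" "u \<in> V" "v \<in> V" "u \<in> W" "v \<notin> W"
  obtains x y where "{x, y} \<in> E" "x \<in> W" "y \<notin> W"
proof -
  have "(u, v) \<in> {(x, y). adj E x y}\<^sup>*"
    using assms by (simp add: graph_connected_def)
  then have "v \<notin> W \<longrightarrow> (\<exists>x y. {x, y} \<in> E \<and> x \<in> W \<and> y \<notin> W)"
    by (induction rule: rtrancl_induct) (use assms in \<open>auto simp: adj_def\<close>)
  with assms that show ?thesis by blast
qed

text \<open>Identifying vertices with equal \<open>f\<close>-value leaves a connected graph on the
  values, whose edges come from the nonconstant edges; a connected graph on k vertices has at least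
  k - 1 edges. The proof grows a spanning tree of this quotient. Below, \<open>f\<close> is a
  coordinate.\<close>

lemma card_image_le_nonconstant_edges:
  fixes f :: "point \<Rightarrow> real"
  assumes tree: "is_tree V E"
  shows "card (f ` V) \<le> card {e \<in> E. \<not> (\<exists>y. \<forall>p\<in>e. f p = y)} + 1" (is "_ \<le> card ?K + 1")
proof -
  have fV: "finite V" and con: "graph_connected V E" using tree by (auto simp: is_tree_def)
  have fK: "finite ?K" using tree_edges_finite[OF tree] by simp
  \<comment> \<open>\<open>W\<close> holds the values reached and \<open>F\<close> the edges used.
    The last conjunct makes every edge that leaves \<open>W\<close> new.\<close>
  have grow: "\<exists>W F. W \<subseteq> f ` V \<and> card W = Suc k \<and> F \<subseteq> ?K \<and> card F = k \<and> (\<forall>e\<in>F. f ` e \<subseteq> W)"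
    if "k < card (f ` V)" for k
    using that
  proof (induction k)
    case 0
    then obtain r where "r \<in> V" using fV by (metis card_gt_0_iff ex_in_conv image_is_empty)
    then show ?case by (intro exI[of _ "{f r}"] exI[of _ "{}"]) auto
  next
    case (Suc k)
    then obtain W F where W: "W \<subseteq> f ` V" "card W = Suc k" and F: "F \<subseteq> ?K" "card F = k"
      and FW: "\<forall>e\<in>F. f ` e \<subseteq> W" by (meson Suc_lessD)
    have "W \<noteq> {}" using W(2) by auto
    with W(1) obtain u where u: "u \<in> V" "f u \<in> W" by blast
    have "W \<noteq> f ` V" using W(2) Suc.prems by auto
    with W(1) obtain v where v: "v \<in> V" "f v \<notin> W" by blast
    obtain x y where xy: "{x, y} \<in> E" "x \<in> f -` W" "y \<notin> f -` W"
      by (rule edge_crossing_cut[OF con u(1) v(1), of "f -` W"]) (use u v in simp_all)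
    have "y \<in> V" using tree_edgeE[OF tree xy(1)] by (metis doubleton_eq_iff)
    have "f x \<in> W" "f y \<notin> W" using xy by simp_all
    then have "f x \<noteq> f y" by metis
    then have xyK: "{x, y} \<in> ?K" using xy(1) by simp
    have xyF: "{x, y} \<notin> F" using \<open>f y \<notin> W\<close> bspec[OF FW, of "{x, y}"] by auto
    have fin: "finite W" "finite F" 
      using finite_subset[OF W(1)] finite_subset[OF F(1) fK] fV by simp_all
    show ?case
    proof (intro exI[of _ "insert (f y) W"] exI[of _ "insert {x, y} F"] conjI)
      show "insert (f y) W \<subseteq> f ` V" using W(1) \<open>y \<in> V\<close> by simp
      show "card (insert (f y) W) = Suc (Suc k)" using W(2) \<open>f y \<notin> W\<close> fin by simp
      show "insert {x, y} F \<subseteq> ?K" using F(1) xyK by simp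
      show "card (insert {x, y} F) = Suc k" using F(2) xyF fin by simp
      show "\<forall>e\<in>insert {x, y} F. f ` e \<subseteq> insert (f y) W"
        using \<open>f x \<in> W\<close> FW by auto
    qed
  qed
  show ?thesis
  proof (cases "card (f ` V)")
    case (Suc k)
    then have "k < card (f ` V)" by simp
    from grow[OF this] obtain F where "F \<subseteq> ?K" "card F = k" by (elim exE conjE)
    then have "k \<le> card ?K" using card_mono[OF fK] by blast
    then show ?thesis unfolding Suc by simp
  qed simp
qed

text \<open>An edge on which \<open>f\<close> is constant determines its level through the value at
  any of its vertices, here the one picked by \<open>SOME\<close>. Hence different levels need
  different edges.\<close>

lemma card_levels_le:
  fixes f :: "point \<Rightarrow> real"
  assumes tree: "is_tree V E" and J: "\<And>j. j \<in> J \<Longrightarrow> \<exists>e\<in>E. \<forall>p\<in>e. f p = j"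
  shows "card J \<le> card {e \<in> E. \<exists>y. \<forall>p\<in>e. f p = y}" (is "_ \<le> card ?H")
proof (rule surj_card_le)
  show "finite ?H" using tree_edges_finite[OF tree] by simp
  show "J \<subseteq> (\<lambda>e. f (SOME p. p \<in> e)) ` ?H"
  proof
    fix j assume "j \<in> J"
    with J obtain e where e: "e \<in> E" "\<forall>p\<in>e. f p = j" by blast
    moreover have "e \<noteq> {}" using tree_edgeE[OF tree e(1)] by blast
    then have "(SOME p. p \<in> e) \<in> e" by (simp add: some_in_eq)
    ultimately show "j \<in> (\<lambda>e. f (SOME p. p \<in> e)) ` ?H" by (intro image_eqI[of _ _ e]) auto
  qed
qed

text \<open>There are at least \<open>card J\<close> constant edges, and connecting these levels
  takes at least \<open>card J - 1\<close> nonconstant ones. This settles the case without free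
  rows, or without free columns.\<close>

lemma card_edges_ge_levels:
  fixes f :: "point \<Rightarrow> real"
  assumes tree: "is_tree V E" and J: "\<And>j. j \<in> J \<Longrightarrow> \<exists>e\<in>E. \<forall>p\<in>e. f p = j"
  shows "2 * card J \<le> card E + 1"
proof -
  let ?H = "{e \<in> E. \<exists>y. \<forall>p\<in>e. f p = y}" and ?K = "{e \<in> E. \<not> (\<exists>y. \<forall>p\<in>e. f p = y)}"
  have "J \<subseteq> f ` V"
  proof
    fix j assume "j \<in> J"
    with J obtain e where "e \<in> E" "\<forall>p\<in>e. f p = j" by blast
    then show "j \<in> f ` V" using tree_edgeE[OF tree] by (metis image_eqI insertI1)
  qed
  then have "card J \<le> card (f ` V)"
    using tree by (intro card_mono) (auto simp: is_tree_def)
  moreover have "card E = card ?H + card ?K"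
    using tree_edges_finite[OF tree] by (subst card_Un_disjoint[symmetric]) (auto intro: arg_cong[of _ _ card])
  ultimately show ?thesis
    using card_levels_le[OF tree J, of J] card_image_le_nonconstant_edges[OF tree, of f] by linarith
qed

subsection \<open>Skew edges\<close>

text \<open>The common factor \<open>c\<close> plays the role of a slope without division, so
  vertical edges need no separate treatment.\<close>

lemma edge_seg_diff:
  fixes u v :: point
  assumes "p \<in> edge_seg {u, v}" "q \<in> edge_seg {u, v}"
  obtains c where "fst p - fst q = c * (fst u - fst v)" "snd p - snd q = c * (snd u - snd v)"
proof -
  obtain s t where "p = (1 - s) *\<^sub>R u + s *\<^sub>R v" "q = (1 - t) *\<^sub>R u + t *\<^sub>R v"
    using assms unfolding edge_seg_doubleton in_segment by blast
  then have "fst p = (1 - s) * fst u + s * fst v" "snd p = (1 - s) * snd u + s * snd v"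
    "fst q = (1 - t) * fst u + t * fst v" "snd q = (1 - t) * snd u + t * snd v"
    by simp_all
  then have "fst p - fst q = (t - s) * (fst u - fst v)" "snd p - snd q = (t - s) * (snd u - snd v)"
    by (simp_all add: algebra_simps)
  then show ?thesis using that by blast
qed

definition skew :: "point set \<Rightarrow> bool" where
  "skew e \<longleftrightarrow> (\<exists>u v. e = {u, v} \<and> fst u \<noteq> fst v \<and> snd u \<noteq> snd v)"

lemma skew_inj:
  assumes "skew e" "p \<in> edge_seg e" "q \<in> edge_seg e" "p \<noteq> q"
  shows "fst p \<noteq> fst q" "snd p \<noteq> snd q"
proof -
  obtain u v where e: "e = {u, v}" "fst u \<noteq> fst v" "snd u \<noteq> snd v"
    using assms(1) unfolding skew_def by blast
  obtain c where "fst p - fst q = c * (fst u - fst v)" "snd p - snd q = c * (snd u - snd v)"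
    using edge_seg_diff[of p u v q] assms(2,3) unfolding e(1) by blast
  moreover from this have "c \<noteq> 0" using assms(4) by (metis eq_iff_diff_eq_0 mult_zero_left prod_eqI)
  ultimately show "fst p \<noteq> fst q" "snd p \<noteq> snd q" using e(2,3) by auto
qed

text \<open>Both coordinate differences are the same multiple of those of the endpoints, so their
  product is scaled by a positive square. Its sign tells whether the edge rises or falls.\<close>

lemma skew_slope_sign:
  assumes "skew e" "p \<in> edge_seg e" "q \<in> edge_seg e" "p' \<in> edge_seg e" "q' \<in> edge_seg e"
    "p \<noteq> q" "p' \<noteq> q'"
  shows "(fst p - fst q) * (snd p - snd q) > 0 \<longleftrightarrow> (fst p' - fst q') * (snd p' - snd q') > 0"
proof -
  obtain u v where e: "e = {u, v}" "fst u \<noteq> fst v" "snd u \<noteq> snd v"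
    using assms(1) unfolding skew_def by blast
  have *: "(fst p - fst q) * (snd p - snd q) > 0 \<longleftrightarrow> (fst u - fst v) * (snd u - snd v) > 0"
    if pq: "p \<in> edge_seg e" "q \<in> edge_seg e" "p \<noteq> q" for p q
  proof -
    obtain c where c: "fst p - fst q = c * (fst u - fst v)" "snd p - snd q = c * (snd u - snd v)"
      using edge_seg_diff[of p u v q] pq(1,2) unfolding e(1) by blast
    then have "c \<noteq> 0" using pq(3) by (metis eq_iff_diff_eq_0 mult_zero_left prod_eqI)
    then have "c * c > 0" by (metis not_real_square_gt_zero)
    moreover have "(fst p - fst q) * (snd p - snd q) = (c * c) * ((fst u - fst v) * (snd u - snd v))"
      unfolding c by (simp only: mult_ac)
    ultimately show ?thesis by (simp only: zero_less_mult_iff[of "c * c"]) auto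
  qed
  show ?thesis using *[of p q] *[of p' q'] assms by simp
qed

text \<open>The endpoints of a segment are extreme points of it.\<close>

lemma endpoint_notin_open_segment:
  assumes "e = {u, v}" "p \<in> edge_seg e" "q \<in> edge_seg e" "z \<in> open_segment p q"
  shows "z \<notin> e"
proof
  assume "z \<in> e"
  then have "z extreme_point_of closed_segment u v" using assms(1) extreme_point_of_segment by blast
  then show False using assms by (auto simp: extreme_point_of_def edge_seg_doubleton)
qed

text \<open>Two common points would make a rising edge and a falling edge agree in slope
  sign.\<close>

lemma skew_seg_Int:
  assumes e: "skew e1" "skew e2" 
    and 1: "p \<in> edge_seg e1" "q \<in> edge_seg e1" and pos: "(fst p - fst q) * (snd p - snd q) > 0"
    and 2: "r \<in> edge_seg e2" "s \<in> edge_seg e2" and neg: "(fst r - fst s) * (snd r - snd s) < 0"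
    and z: "z \<in> edge_seg e1" "z \<in> edge_seg e2"
  shows "edge_seg e1 \<inter> edge_seg e2 = {z}"
proof -
  have "p \<noteq> q" "r \<noteq> s" using pos neg by auto
  have "w = z" if w: "w \<in> edge_seg e1" "w \<in> edge_seg e2" for w
  proof (rule ccontr)
    assume "w \<noteq> z"
    have "(fst w - fst z) * (snd w - snd z) > 0"
      using skew_slope_sign[OF e(1) w(1) z(1) 1 \<open>w \<noteq> z\<close> \<open>p \<noteq> q\<close>] pos by blast
    then have "(fst r - fst s) * (snd r - snd s) > 0"
      using skew_slope_sign[OF e(2) w(2) z(2) 2 \<open>w \<noteq> z\<close> \<open>r \<noteq> s\<close>] by blast
    then show False using neg by linarith
  qed
  then show ?thesis using z by blast
qed

section \<open>Proper crossings of a rising and a falling edge\<close>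

text \<open>The segment from (0, 0) to (p, H) is met by the one from (0, H) to (s, t), because the
  last hypothesis puts (s, t) on or to the right of the line of the former. The parameters
  \<open>u\<close> and \<open>v\<close> come from Cramer's rule with determinant \<open>d\<close>;
  \<open>t < H\<close> makes \<open>u < 1\<close> strict.\<close>

lemma diagonal_intersection:
  fixes p H s t :: real
  assumes "0 < p" "0 < H" "0 < s" "t < H" "p * t \<le> H * s"
  obtains u v where "0 < u" "u < 1" "0 \<le> v" "v \<le> 1" "u * p = v * s" "u * H = H + v * (t - H)"
proof -
  define d where "d = H * s + p * (H - t)"
  have pos: "0 < H * s" "0 < p * (H - t)" using assms by auto
  then have d: "d > 0" by (simp add: d_def)
  show ?thesis
  proof (rule that[of "H * s / d" "p * H / d"])
    show "0 < H * s / d" "0 \<le> p * H / d" using pos(1) d assms(1,2) by simp_all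
    have "H * s < d" "p * H \<le> d" using pos(2) assms(5) unfolding d_def
      by (linarith, simp only: right_diff_distrib)
    then show "H * s / d < 1" "p * H / d \<le> 1" using d by simp_all
    show "H * s / d * p = p * H / d * s" by simp
    have "H * (H * s) = H * d + p * H * (t - H)" by (simp add: d_def algebra_simps)
    then have "H * (H * s) / d = (H * d + p * H * (t - H)) / d" by (rule arg_cong)
    then show "H * s / d * H = H + p * H / d * (t - H)" using d by (simp add: add_divide_distrib mult.commute)
  qed
qed

text \<open>Strictness of \<open>u\<close> puts the common point inside a chord of
  \<open>e1\<close>, hence away from its endpoints. On \<open>e2\<close> it may be an endpoint, so
  \<open>v\<close> ranges over the closed interval.\<close>

lemma skew_crossing:
  assumes e: "skew e1" "skew e2"
    and 1: "p \<in> edge_seg e1" "q \<in> edge_seg e1" and pos: "(fst p - fst q) * (snd p - snd q) > 0"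
    and 2: "r \<in> edge_seg e2" "s \<in> edge_seg e2" and neg: "(fst r - fst s) * (snd r - snd s) < 0"
    and u: "0 < u" "u < 1" and v: "0 \<le> v" "v \<le> 1"
    and eq: "(1 - u) *\<^sub>R p + u *\<^sub>R q = (1 - v) *\<^sub>R r + v *\<^sub>R s"
  shows "\<exists>z. edge_seg e1 \<inter> edge_seg e2 = {z} \<and> z \<notin> e1"
proof -
  define z where "z = (1 - u) *\<^sub>R p + u *\<^sub>R q"
  have "p \<noteq> q" using pos by auto
  then have zo: "z \<in> open_segment p q"
    using u unfolding in_segment z_def by blast
  have seg: "closed_segment p q \<subseteq> edge_seg e" if "p \<in> edge_seg e" "q \<in> edge_seg e" for p q e
    using that closed_segment_subset[of p "edge_seg e" q] by (simp add: edge_seg_def)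
  have z1: "z \<in> edge_seg e1" using zo seg[OF 1] unfolding open_segment_def by blast
  have "z \<in> closed_segment r s" using v unfolding z_def eq in_segment by blast
  then have "z \<in> edge_seg e2" using seg[OF 2] by blast
  then have "edge_seg e1 \<inter> edge_seg e2 = {z}"
    using skew_seg_Int[OF e 1 pos 2 neg z1] by blast
  moreover obtain a b where "e1 = {a, b}" using e(1) unfolding skew_def by blast
  then have "z \<notin> e1" using endpoint_notin_open_segment[OF _ 1 zo] by blast
  ultimately show ?thesis by blast
qed

text \<open>This is \<open>diagonal_intersection\<close> with the origin moved to the lower left
  corner (x0, y0); \<open>e1\<close> runs from there to the height of the upper left corner, where
  \<open>e2\<close> starts.\<close>

lemma left_corners_crossing:
  assumes e: "skew e1" "skew e2"
    and 1: "(x0, y0) \<in> edge_seg e1" "(xp, y1) \<in> edge_seg e1"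
    and 2: "(x0, y1) \<in> edge_seg e2" "(s, t) \<in> edge_seg e2"
    and ord: "x0 < xp" "y0 < y1" "x0 < s" "t < y1"
    and c: "(xp - x0) * (t - y0) \<le> (y1 - y0) * (s - x0)"
  shows "\<exists>z. edge_seg e1 \<inter> edge_seg e2 = {z} \<and> z \<notin> e1"
proof -
  obtain u v where uv: "0 < u" "u < 1" "0 \<le> v" "v \<le> 1" "u * (xp - x0) = v * (s - x0)"
    "u * (y1 - y0) = (y1 - y0) + v * ((t - y0) - (y1 - y0))"
    using diagonal_intersection[of "xp - x0" "y1 - y0" "s - x0" "t - y0"] ord c by auto
  have "(1 - u) *\<^sub>R (x0, y0) + u *\<^sub>R (xp, y1) = (1 - v) *\<^sub>R (x0, y1) + v *\<^sub>R (s, t)"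
    using uv(5,6) by (simp add: algebra_simps)
  then show ?thesis
    using ord by (intro skew_crossing[OF e 1 _ 2 _ uv(1-4)])
      (simp_all add: zero_less_mult_iff mult_less_0_iff)
qed

text \<open>The mirror image of \<open>left_corners_crossing\<close>, with the two coordinates
  exchanged.\<close>

lemma lower_corners_crossing:
  assumes e: "skew e1" "skew e2"
    and 1: "(x0, y0) \<in> edge_seg e1" "(x1, yp) \<in> edge_seg e1"
    and 2: "(x1, y0) \<in> edge_seg e2" "(s, t) \<in> edge_seg e2"
    and ord: "y0 < yp" "x0 < x1" "y0 < t" "s < x1"
    and c: "(yp - y0) * (s - x0) \<le> (x1 - x0) * (t - y0)"
  shows "\<exists>z. edge_seg e1 \<inter> edge_seg e2 = {z} \<and> z \<notin> e1"
proof -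
  obtain u v where uv: "0 < u" "u < 1" "0 \<le> v" "v \<le> 1" "u * (yp - y0) = v * (t - y0)"
    "u * (x1 - x0) = (x1 - x0) + v * ((s - x0) - (x1 - x0))"
    using diagonal_intersection[of "yp - y0" "x1 - x0" "t - y0" "s - x0"] ord c by auto
  have "(1 - u) *\<^sub>R (x0, y0) + u *\<^sub>R (x1, yp) = (1 - v) *\<^sub>R (x1, y0) + v *\<^sub>R (s, t)"
    using uv(5,6) by (simp add: algebra_simps)
  then show ?thesis
    using ord by (intro skew_crossing[OF e 1 _ 2 _ uv(1-4)])
      (simp_all add: zero_less_mult_iff mult_less_0_iff)
qed

lemma skew_monotone:
  assumes e: "skew e" and pqr: "p \<in> edge_seg e" "q \<in> edge_seg e" "r \<in> edge_seg e"
    and ord: "fst p < fst q" "fst q < fst r"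
  shows "snd p < snd q \<and> snd q < snd r \<or> snd r < snd q \<and> snd q < snd p"
proof -
  have ne: "p \<noteq> q" "q \<noteq> r" using ord by auto
  have "(fst p - fst q) * (snd p - snd q) > 0 \<longleftrightarrow> (fst q - fst r) * (snd q - snd r) > 0"
    by (rule skew_slope_sign[OF e pqr(1,2) pqr(2,3) ne])
  then have "snd p < snd q \<longleftrightarrow> snd q < snd r"
    using ord by (simp add: zero_less_mult_iff)
  moreover have "snd p \<noteq> snd q" "snd q \<noteq> snd r"
    using skew_inj(2)[OF e] pqr ne by blast+
  ultimately show ?thesis by linarith
qed

section \<open>Skew edges and the frame of a product set\<close>

text \<open>The boundary of the array, in which \<open>B\<close> holds the abscissas and
  \<open>A\<close> the ordinates. Written as a difference of two products, it is counted by one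
  subtraction.\<close>

definition frame :: "real set \<Rightarrow> real set \<Rightarrow> point set" where
  "frame B A = B \<times> A - (B - {Min B, Max B}) \<times> (A - {Min A, Max A})"

lemma card_frame:
  assumes "2 \<le> card A" "2 \<le> card B"
  shows "card (frame B A) + 4 = 2 * card A + 2 * card B"
proof -
  have fin: "finite A" "finite B" and ne: "A \<noteq> {}" "B \<noteq> {}" using assms by (auto intro: card_ge_0_finite)
  have "Min X \<noteq> Max X" if "2 \<le> card X" "finite X" for X :: "real set"
  proof
    assume "Min X = Max X"
    then have "X \<subseteq> {Min X}" using that(2) by (metis Max_ge Min_le antisym singletonI subsetI)
    then have "card X \<le> 1" by (metis card_mono card.empty card_insert_disjoint empty_iff finite.intros One_nat_def)
    then show False using that(1) by simp
  qed
  note distinct = this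
  have inner: "card (X - {Min X, Max X}) = card X - 2" if "2 \<le> card X" "finite X" for X :: "real set"
  proof -
    have "X \<noteq> {}" using that(1) by auto
    then have "{Min X, Max X} \<subseteq> X" using that(2) by simp
    then show ?thesis using distinct[OF that] by (subst card_Diff_subset) simp_all
  qed
  obtain a b where ab: "card A = a + 2" "card B = b + 2" using assms by (metis add.commute le_Suc_ex)
  have "card (frame B A) = card (B \<times> A) - card ((B - {Min B, Max B}) \<times> (A - {Min A, Max A}))"
    unfolding frame_def using fin by (intro card_Diff_subset) auto
  also have "\<dots> = (b + 2) * (a + 2) - b * a"
    using ab inner[OF assms(1) fin(1)] inner[OF assms(2) fin(2)] by (simp add: card_cartesian_product)
  finally show ?thesis using ab by simp
qed

lemma frame_corner:
  assumes "finite A" "A \<noteq> {}" "finite B" "B \<noteq> {}" "x \<in> {Min B, Max B}" "y \<in> {Min A, Max A}"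
  shows "(x, y) \<in> frame B A"
  using assms Min_in[of A] Max_in[of A] Min_in[of B] Max_in[of B] unfolding frame_def by blast

text \<open>By monotonicity, the middle one of three points on a skew edge lies strictly between the
  others in both coordinates, so neither of its coordinates is extreme.\<close>

lemma skew_Int_frame:
  assumes e: "skew e" and fin: "finite A" "finite B"
  shows "card (edge_seg e \<inter> frame B A) \<le> 2"
proof (rule ccontr)
  let ?T = "edge_seg e \<inter> frame B A"
  assume "\<not> card ?T \<le> 2"
  then have "3 \<le> card ?T" by simp
  then obtain T where T: "T \<subseteq> ?T" "card T = 3" by (rule obtain_subset_with_card_n)
  then obtain p q r where pqr: "p \<in> ?T" "q \<in> ?T" "r \<in> ?T" "p \<noteq> q" "q \<noteq> r" "p \<noteq> r"
    by (metis card_3_iff insert_subset)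
  have no_middle: False
    if T: "p \<in> ?T" "q \<in> ?T" "r \<in> ?T" and ord: "fst p < fst q" "fst q < fst r" for p q r
  proof -
    have in_box: "Min B \<le> fst w \<and> fst w \<le> Max B \<and> Min A \<le> snd w \<and> snd w \<le> Max A"
      if "w \<in> ?T" for w
      using that fin unfolding frame_def by (cases w) simp
    have "snd p < snd q \<and> snd q < snd r \<or> snd r < snd q \<and> snd q < snd p"
      by (rule skew_monotone[OF e _ _ _ ord]) (use T in simp_all)
    then have "fst q \<noteq> Min B" "fst q \<noteq> Max B" "snd q \<noteq> Min A" "snd q \<noteq> Max A"
      using in_box[OF T(1)] in_box[OF T(3)] ord by linarith+
    then show False using T(2) unfolding frame_def by (cases q) auto
  qed
  have "fst p \<noteq> fst q" "fst q \<noteq> fst r" "fst p \<noteq> fst r"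
    using pqr skew_inj(1)[OF e] by blast+
  then show False
    using no_middle pqr(1-3) by (metis linorder_neqE_linordered_idom)
qed

text \<open>Double counting: the frame has 2a + 2b - 4 points, where a and b are the sizes of
  \<open>A\<close> and \<open>B\<close>, and each edge covers at most two of them. In case of
  equality no edge can cover fewer than two.\<close>

lemma skew_frame_tight:
  assumes fin: "finite S" and sk: "\<And>e. e \<in> S \<Longrightarrow> skew e"
    and cA: "2 \<le> card A" and cB: "2 \<le> card B"
    and cov: "B \<times> A \<subseteq> (\<Union>e\<in>S. edge_seg e)"
  shows "card A + card B \<le> card S + 2"
    and "card S + 2 \<le> card A + card B \<Longrightarrow> e \<in> S \<Longrightarrow> card (edge_seg e \<inter> frame B A) = 2"
proof -
  have finAB: "finite A" "finite B" using cA cB by (auto intro: card_ge_0_finite)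
  let ?t = "\<lambda>e. card (edge_seg e \<inter> frame B A)"
  have t2: "?t e \<le> 2" if "e \<in> S" for e using skew_Int_frame[OF sk[OF that] finAB] .
  have "frame B A \<subseteq> B \<times> A" unfolding frame_def by blast
  then have "frame B A = (\<Union>e\<in>S. edge_seg e \<inter> frame B A)" using cov by blast
  then have le: "card (frame B A) \<le> (\<Sum>e\<in>S. ?t e)"
    using card_UN_le[OF fin, of "\<lambda>e. edge_seg e \<inter> frame B A"] by simp
  also have "\<dots> \<le> (\<Sum>e\<in>S. 2)" by (rule sum_mono) (rule t2)
  finally have "card (frame B A) \<le> 2 * card S" by simp
  then show "card A + card B \<le> card S + 2" using card_frame[OF cA cB] by linarith
  show "?t e = 2" if tight: "card S + 2 \<le> card A + card B" and e: "e \<in> S"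
  proof (rule ccontr)
    assume "?t e \<noteq> 2"
    then have "?t e < 2" using t2[OF e] by simp
    then have "(\<Sum>e\<in>S. ?t e) < (\<Sum>e\<in>S. 2)"
      by (intro sum_strict_mono_ex1 fin ballI t2 bexI[OF _ e])
    then show False using le tight card_frame[OF cA cB] by simp
  qed
qed

text \<open>
  In the tight case every skew edge joins exactly two points of the frame. The edge at the lower
  left corner ends on the top or on the right side; it then separates the upper left or the lower
  right corner, respectively, from all points the edge at that corner could end at.
\<close>

lemma skew_frame_crossing:
  assumes fin: "finite S" and sk: "\<And>e. e \<in> S \<Longrightarrow> skew e"
    and cA: "2 \<le> card A" and cB: "2 \<le> card B"
    and cov: "B \<times> A \<subseteq> (\<Union>e\<in>S. edge_seg e)"
    and tight: "card S + 2 \<le> card A + card B"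
  obtains e1 e2 z where "e1 \<in> S" "e2 \<in> S" "edge_seg e1 \<inter> edge_seg e2 = {z}" "z \<notin> e1"
proof -
  have finAB: "finite A" "finite B" using cA cB by (auto intro: card_ge_0_finite)
  have neAB: "A \<noteq> {}" "B \<noteq> {}" using cA cB by auto
  define x0 x1 y0 y1 where defs: "x0 = Min B" "x1 = Max B" "y0 = Min A" "y1 = Max A"
  have frame: "x0 \<le> x" "x \<le> x1" "y0 \<le> y" "y \<le> y1" "x = x0 \<or> x = x1 \<or> y = y0 \<or> y = y1"
    if "(x, y) \<in> frame B A" for x y
    using that finAB unfolding frame_def defs by auto
  \<comment> \<open>By tightness the edge through a corner contains another frame point, and by
    skewness that point shares neither coordinate with the corner.\<close>
  have corner: "\<exists>e\<in>S. \<exists>s t. (x, y) \<in> edge_seg e \<and> (s, t) \<in> edge_seg e \<and> (s, t) \<in> frame B A \<and> s \<noteq> x \<and> t \<noteq> y"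
    if "x = x0 \<or> x = x1" "y = y0 \<or> y = y1" for x y
  proof -
    have c: "(x, y) \<in> frame B A"
      using frame_corner[OF finAB(1) neAB(1) finAB(2) neAB(2)] that unfolding defs by blast
    then obtain e where e: "e \<in> S" "(x, y) \<in> edge_seg e"
      using cov unfolding frame_def by blast
    have "card (edge_seg e \<inter> frame B A) = 2"
      by (rule skew_frame_tight(2)[OF fin sk cA cB cov tight e(1)])
    then obtain a b where ab: "edge_seg e \<inter> frame B A = {a, b}" "a \<noteq> b" by (auto simp: card_2_iff)
    then obtain p where p: "p \<in> edge_seg e" "p \<in> frame B A" "p \<noteq> (x, y)" by blast
    then have "fst p \<noteq> fst (x, y)" "snd p \<noteq> snd (x, y)"
      using skew_inj[OF sk[OF e(1)] p(1) e(2)] by blast+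
    then show ?thesis using p e by (metis fst_conv snd_conv surj_pair)
  qed
  obtain e1 xp yp where e1: "e1 \<in> S" "(x0, y0) \<in> edge_seg e1" "(xp, yp) \<in> edge_seg e1"
    and p: "(xp, yp) \<in> frame B A" "xp \<noteq> x0" "yp \<noteq> y0"
    using corner[of x0 y0] by blast
  have ord: "x0 < xp" "y0 < yp" "xp \<le> x1" "yp \<le> y1" using frame[OF p(1)] p(2,3) by auto
  consider "yp = y1" | "xp = x1" using frame(5)[OF p(1)] p(2,3) by blast
  then show ?thesis
  proof cases
    case 1
    obtain e2 s t where e2: "e2 \<in> S" "(x0, y1) \<in> edge_seg e2" "(s, t) \<in> edge_seg e2"
      and st: "(s, t) \<in> frame B A" "s \<noteq> x0" "t \<noteq> y1"
      using corner[of x0 y1] by blast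
    have o: "x0 < s" "t < y1" "s \<le> x1" "y0 \<le> t" using frame[OF st(1)] st(2,3) by auto
    \<comment> \<open>Either (s, t) is on the bottom side and the left-hand side vanishes, or it is
      on the right side and the factors compare separately, by \<open>t < y1\<close> and
      \<open>xp \<le> x1 = s\<close>.\<close>
    have "(xp - x0) * (t - y0) \<le> (y1 - y0) * (s - x0)"
    proof (cases "t = y0")
      case False
      then have "s = x1" using frame(5)[OF st(1)] st(2,3) by blast
      then have "(t - y0) * (xp - x0) \<le> (y1 - y0) * (s - x0)"
        using ord o by (intro mult_mono) auto
      then show ?thesis by (simp only: mult.commute)
    qed (use o ord in simp)
    then show ?thesis
      using left_corners_crossing[OF sk[OF e1(1)] sk[OF e2(1)] e1(2) _ e2(2,3) ord(1) _ o(1,2)]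
        e1 e2 ord 1 that by blast
  next
    case 2
    obtain e2 s t where e2: "e2 \<in> S" "(x1, y0) \<in> edge_seg e2" "(s, t) \<in> edge_seg e2"
      and st: "(s, t) \<in> frame B A" "s \<noteq> x1" "t \<noteq> y0"
      using corner[of x1 y0] by blast
    have o: "y0 < t" "s < x1" "t \<le> y1" "x0 \<le> s" using frame[OF st(1)] st(2,3) by auto
    have "(yp - y0) * (s - x0) \<le> (x1 - x0) * (t - y0)"
    proof (cases "s = x0")
      case False
      then have "t = y1" using frame(5)[OF st(1)] st(2,3) by blast
      then have "(s - x0) * (yp - y0) \<le> (x1 - x0) * (t - y0)"
        using ord o by (intro mult_mono) auto
      then show ?thesis by (simp only: mult.commute)
    qed (use o ord in simp)
    then show ?thesis
      using lower_corners_crossing[OF sk[OF e1(1)] sk[OF e2(1)] e1(2) _ e2(2,3) ord(2) _ o(1,2)]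
        e1 e2 ord 2 that by blast
  qed
qed

subsection \<open>Lower bounds\<close>

lemma card_uncovered_levels:
  fixes f :: "point \<Rightarrow> real"
  assumes tree: "is_tree V E"
    and L: "finite L" and A: "A = {j \<in> L. \<not> (\<exists>e\<in>E. \<forall>p\<in>e. f p = j)}"
  shows "card L \<le> card {e \<in> E. \<exists>y. \<forall>p\<in>e. f p = y} + card A"
    and "A = {} \<Longrightarrow> 2 * card L \<le> card E + 1"
proof -
  have "card (L - A) \<le> card {e \<in> E. \<exists>y. \<forall>p\<in>e. f p = y}"
    by (rule card_levels_le[OF tree]) (auto simp: A)
  moreover have "card L = card (L - A) + card A"
    using L A card_Diff_subset[of A L] card_mono[of L A] finite_subset[of A L] by auto
  ultimately show "card L \<le> card {e \<in> E. \<exists>y. \<forall>p\<in>e. f p = y} + card A" by simp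
  show "2 * card L \<le> card E + 1" if "A = {}"
    by (rule card_edges_ge_levels[OF tree, where f = f]) (use that A in auto)
qed

text \<open>A skew edge meets an axis-parallel line at most once, so choosing for each point an edge
  through it is injective. This serves the case of a single free row or column.\<close>

lemma card_line_le_skew:
  assumes fin: "finite S" and sk: "\<And>e. e \<in> S \<Longrightarrow> skew e"
    and cov: "P \<subseteq> (\<Union>e\<in>S. edge_seg e)"
    and line: "\<And>p q. p \<in> P \<Longrightarrow> q \<in> P \<Longrightarrow> fst p = fst q \<or> snd p = snd q"
  shows "card P \<le> card S"
proof -
  have "\<forall>p\<in>P. \<exists>e. e \<in> S \<and> p \<in> edge_seg e" using cov by blast
  from bchoice[OF this] obtain g where g: "\<And>p. p \<in> P \<Longrightarrow> g p \<in> S \<and> p \<in> edge_seg (g p)" by blast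
  have "inj_on g P"
  proof (rule inj_onI, rule ccontr)
    fix p q assume pq: "p \<in> P" "q \<in> P" "g p = g q" "p \<noteq> q"
    then have "p \<in> edge_seg (g p)" "q \<in> edge_seg (g p)" "g p \<in> S" using g by metis+
    then show False using skew_inj[OF sk _ _ pq(4)] line[OF pq(1,2)] by blast
  qed
  moreover have "g ` P \<subseteq> S" using g by blast
  ultimately show ?thesis using card_inj_on_le fin by blast
qed

text \<open>The common source of all lower bounds. With a free rows and b free columns, both at
  least 2, there are at least (m - a) + (n - b) + (a + b - 2) edges; the assumption
  \<open>few\<close> then forces equality throughout, hence a square and a tight frame.\<close>

lemma covering_tree_card:
  assumes gt: "geometric_tree V E" and cov: "covers E (grid n m)"
    and few: "card E + 2 \<le> 2 * min n m"
  obtains e1 e2 z where "n = m" "2 \<le> n" "card E + 2 = 2 * n"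
    "e1 \<in> E" "e2 \<in> E" "edge_seg e1 \<inter> edge_seg e2 = {z}" "z \<notin> e1"
proof -
  have tree: "is_tree V E" using gt by (simp add: geometric_tree_def)
  have finE: "finite E" by (rule tree_edges_finite[OF tree])
  define X Y where XY: "X = real ` {1..n}" "Y = real ` {1..m}"
  have finXY: "finite X" "finite Y" and cardXY: "card X = n" "card Y = m"
    by (simp_all add: XY card_image)
  \<comment> \<open>\<open>A\<close> and \<open>B\<close> are the free rows and columns;
    \<open>H\<close>, \<open>W\<close> and \<open>S\<close> are the horizontal, vertical and skew
    edges.\<close>
  define A where "A = {j \<in> Y. \<not> (\<exists>e\<in>E. \<forall>p\<in>e. snd p = j)}"
  define B where "B = {j \<in> X. \<not> (\<exists>e\<in>E. \<forall>p\<in>e. fst p = j)}"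
  define H where "H = {e \<in> E. \<exists>y. \<forall>p\<in>e. snd p = y}"
  define W where "W = {e \<in> E. \<exists>y. \<forall>p\<in>e. fst p = y}"
  define S where "S = E - H - W"
  note rows = card_uncovered_levels[OF tree finXY(2) A_def, folded H_def, unfolded cardXY]
  note cols = card_uncovered_levels[OF tree finXY(1) B_def, folded W_def, unfolded cardXY]
  have finAB: "finite A" "finite B" using finXY by (simp_all add: A_def B_def)
  have finS: "finite S" using finE by (simp add: S_def)
  have "H \<inter> W = {}"
  proof -
    have False if "e \<in> E" "\<forall>p\<in>e. snd p = y" "\<forall>p\<in>e. fst p = x" for e x y
      using tree_edgeE[OF tree that(1)] that(2,3) by (metis insertI1 insertI2 prod_eqI)
    then show ?thesis unfolding H_def W_def by blast
  qed
  then have "card (H \<union> W) = card H + card W"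
    using finE by (intro card_Un_disjoint) (simp_all add: H_def W_def)
  moreover have "card E = card S + card (H \<union> W)"
    using finE card_Diff_subset[of "H \<union> W" E] card_mono[of E "H \<union> W"]
    by (auto simp: S_def H_def W_def Diff_eq Int_assoc)
  ultimately have cardE: "card E = card H + card W + card S" by simp
  have sk: "skew e" if "e \<in> S" for e
  proof -
    from that have "e \<in> E" by (simp add: S_def)
    then obtain u v where uv: "e = {u, v}" using tree_edgeE[OF tree] by metis
    then have "snd u \<noteq> snd v" "fst u \<noteq> fst v"
      using that \<open>e \<in> E\<close> unfolding S_def H_def W_def by auto
    then show ?thesis using uv unfolding skew_def by blast
  qed
  \<comment> \<open>A horizontal or vertical edge through such a point would lie along its row or
    column, which is free.\<close>
  have covAB: "B \<times> A \<subseteq> (\<Union>e\<in>S. edge_seg e)"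
  proof
    fix p assume p: "p \<in> B \<times> A"
    then have "p \<in> grid n m" unfolding A_def B_def XY grid_def by auto
    then obtain e where e: "e \<in> E" "p \<in> edge_seg e" using cov unfolding covers_def by blast
    have const: "f p = y" if "\<forall>q\<in>e. f q = y" "f = fst \<or> f = snd" for f :: "point \<Rightarrow> real" and y
    proof -
      obtain u v where uv: "e = {u, v}" using tree_edgeE[OF tree e(1)] by metis
      then have "u \<in> edge_seg {u, v}" by (simp add: edge_seg_doubleton)
      with e uv obtain c where "fst p - fst u = c * (fst u - fst v)" "snd p - snd u = c * (snd u - snd v)"
        using edge_seg_diff[of p u v u] by blast
      then show ?thesis using that uv by auto
    qed
    have "e \<notin> H"
    proof
      assume "e \<in> H"
      then obtain y where y: "\<forall>q\<in>e. snd q = y" unfolding H_def by blast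
      with const[of snd] have "snd p = y" by blast
      with y e(1) have "snd p \<notin> A" unfolding A_def by blast
      then show False using p by auto
    qed
    moreover have "e \<notin> W"
    proof
      assume "e \<in> W"
      then obtain x where x: "\<forall>q\<in>e. fst q = x" unfolding W_def by blast
      with const[of fst] have "fst p = x" by blast
      with x e(1) have "fst p \<notin> B" unfolding B_def by blast
      then show False using p by auto
    qed
    ultimately show "p \<in> (\<Union>e\<in>S. edge_seg e)" using e unfolding S_def by blast
  qed
  \<comment> \<open>The points of a single free row need \<open>card B\<close> different skew edges,
    which gives at least (m - 1) + (n - card B) + card B edges, too many for
    \<open>few\<close>.\<close>
  have A1: "card A \<noteq> 1"
  proof
    assume "card A = 1"
    then obtain y where y: "A = {y}" by (rule card_1_singletonE)
    have "card ((\<lambda>x. (x, y)) ` B) \<le> card S"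
      by (rule card_line_le_skew[OF finS sk]) (use covAB y in auto)
    moreover have "card ((\<lambda>x. (x, y)) ` B) = card B" by (intro card_image) (simp add: inj_on_def)
    ultimately have "card B \<le> card S" by simp
    then show False using rows(1) cols(1) cardE few \<open>card A = 1\<close> by linarith
  qed
  have B1: "card B \<noteq> 1"
  proof
    assume "card B = 1"
    then obtain x where x: "B = {x}" by (rule card_1_singletonE)
    have "card ((\<lambda>y. (x, y)) ` A) \<le> card S"
      by (rule card_line_le_skew[OF finS sk]) (use covAB x in auto)
    moreover have "card ((\<lambda>y. (x, y)) ` A) = card A" by (intro card_image) (simp add: inj_on_def)
    ultimately have "card A \<le> card S" by simp
    then show False using rows(1) cols(1) cardE few \<open>card B = 1\<close> by linarith
  qed
  \<comment> \<open>Without free rows there are at least 2m - 1 edges, without free columns at least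
    2n - 1.\<close>
  have "A \<noteq> {}" "B \<noteq> {}" using rows(2) cols(2) few by auto
  then have "card A \<noteq> 0" "card B \<noteq> 0" using finAB by auto
  with A1 B1 have AB2: "2 \<le> card A" "2 \<le> card B" by linarith+
  have "card A + card B \<le> card S + 2"
    by (rule skew_frame_tight(1)[OF finS sk AB2 covAB])
  then have eqs: "n = m" "card E + 2 = 2 * n" "card S + 2 \<le> card A + card B"
    using rows(1) cols(1) cardE few by linarith+
  have "card A \<le> m" using card_mono[OF finXY(2), of A] cardXY by (auto simp: A_def)
  then have "2 \<le> n" using AB2 eqs by simp
  obtain e1 e2 z where e: "e1 \<in> S" "e2 \<in> S" "edge_seg e1 \<inter> edge_seg e2 = {z}" "z \<notin> e1"
    by (rule skew_frame_crossing[OF finS sk AB2 covAB eqs(3)])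
  show ?thesis
    by (rule that[OF eqs(1) \<open>2 \<le> n\<close> eqs(2) _ _ e(3,4)]) (use e(1,2) in \<open>simp_all add: S_def\<close>)
qed

lemma edge_subset_seg: "e \<subseteq> edge_seg e"
  unfolding edge_seg_def by (rule hull_subset)

lemma noncrossing_covering_tree_card:
  assumes "geometric_tree V E" "covers E (grid n m)" "noncrossing E"
  shows "2 * min n m - 1 \<le> card E"
proof (rule ccontr)
  assume "\<not> ?thesis"
  then have "card E + 2 \<le> 2 * min n m" by linarith
  then obtain e1 e2 z where e: "e1 \<in> E" "e2 \<in> E" "edge_seg e1 \<inter> edge_seg e2 = {z}" "z \<notin> e1"
    by (rule covering_tree_card[OF assms(1,2)]) 
  \<comment> \<open>Otherwise the segment of \<open>e1\<close> would be the single point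
    \<open>z\<close>, which would then be an endpoint of \<open>e1\<close>.\<close>
  moreover have "e1 \<noteq> e2" using e edge_subset_seg[of e1] tree_edgeE[of V E e1] assms(1)
    by (metis Int_absorb geometric_tree_def insertI1 singletonD subset_iff)
  ultimately show False using assms(3) unfolding noncrossing_def
    by (metis IntD1 insert_not_empty singleton_inject)
qed

text \<open>Only n = m = 2 with two edges is left. Their one common point is not an endpoint of
  \<open>e1\<close>, so they share no vertex and the tree would be disconnected.\<close>

lemma covering_tree_card_unless_square:
  assumes gt: "geometric_tree V E" and cov: "covers E (grid n m)" and ne: "\<not> (n = m \<and> 3 \<le> n)"
  shows "2 * min n m - 1 \<le> card E"
proof (rule ccontr)
  assume "\<not> ?thesis"
  then have "card E + 2 \<le> 2 * min n m" by linarith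
  then obtain e1 e2 z where nm: "n = m" "2 \<le> n" "card E + 2 = 2 * n"
    and e: "e1 \<in> E" "e2 \<in> E" "edge_seg e1 \<inter> edge_seg e2 = {z}" "z \<notin> e1"
    by (rule covering_tree_card[OF gt cov])
  have tree: "is_tree V E" using gt by (simp add: geometric_tree_def)
  have disj: "e1 \<inter> e2 = {}" using e(3,4) edge_subset_seg[of e1] edge_subset_seg[of e2] by auto
  obtain u1 v1 where uv1: "u1 \<in> V" "e1 = {u1, v1}" using tree_edgeE[OF tree e(1)] by metis
  obtain u2 v2 where uv2: "u2 \<in> V" "e2 = {u2, v2}" using tree_edgeE[OF tree e(2)] by metis
  have "card E = 2" using nm ne by linarith
  moreover have "e1 \<noteq> e2" using disj uv1 by blast
  then have "card {e1, e2} = 2" by simp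
  ultimately have E: "{e1, e2} = E"
    using e tree_edges_finite[OF tree] by (intro card_subset_eq) auto
  have "graph_connected V E" using tree by (simp add: is_tree_def)
  then obtain x y where "{x, y} \<in> E" "x \<in> e1" "y \<notin> e1"
    using edge_crossing_cut[of V E u1 u2 e1] uv1 uv2 disj by blast
  then show False using disj unfolding E[symmetric] by blast
qed

subsection \<open>Constructing trees\<close>

lemma is_tree_singleton: "is_tree {v} {}"
  unfolding is_tree_def graph_connected_def is_cycle_def adj_def by auto

lemma fresh_edge_notin:
  assumes "is_tree V E" "w \<notin> V"
  shows "{u, w} \<notin> E"
  using tree_edgeE[OF assms(1)] assms(2) by (metis insertE insertI1 insertI2 singletonD)

text \<open>A vertex on a cycle has two distinct neighbours there, whereas the only neighbour of
  \<open>w\<close> is \<open>u\<close>. So a cycle avoids \<open>w\<close> and already lies in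
  \<open>E\<close>.\<close>

lemma is_tree_add_leaf:
  assumes tree: "is_tree V E" and u: "u \<in> V" and w: "w \<notin> V"
  shows "is_tree (insert w V) (insert {u, w} E)" (is "is_tree ?V ?E")
proof -
  have adj_w: "y = u" if "adj ?E w y \<or> adj ?E y w" for y
    using that fresh_edge_notin[OF tree w, of y] u w unfolding adj_def
    by (auto simp: insert_commute doubleton_eq_iff)
  have no_cycle: "\<not> is_cycle ?E cs" for cs
  proof
    assume cyc: "is_cycle ?E cs"
    then have len: "3 \<le> length cs" and "cs \<noteq> []" and dist: "distinct cs"
      and step: "\<And>i. i < length cs - 1 \<Longrightarrow> adj ?E (cs ! i) (cs ! Suc i)"
      unfolding is_cycle_def by auto
    have close: "adj ?E (cs ! (length cs - 1)) (cs ! 0)"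
      using cyc hd_conv_nth[OF \<open>cs \<noteq> []\<close>] last_conv_nth[OF \<open>cs \<noteq> []\<close>] unfolding is_cycle_def by simp
    show False
    proof (cases "w \<in> set cs")
      case True
      then obtain i where i: "i < length cs" "cs ! i = w" by (metis in_set_conv_nth)
      \<comment> \<open>The cyclic successor and predecessor of position \<open>i\<close>; they
        differ because a cycle has length at least 3.\<close>
      define a where "a = (if i = length cs - 1 then 0 else Suc i)"
      define b where "b = (if i = 0 then length cs - 1 else i - 1)"
      have ab: "a < length cs" "b < length cs" "a \<noteq> b"
        using i(1) len unfolding a_def b_def by auto
      have "cs ! a = u"
        using adj_w[of "cs ! a"] step[of i] close i unfolding a_def by (auto split: if_splits)
      moreover have "cs ! b = u"
        using adj_w[of "cs ! b"] step[of "i - 1"] close i unfolding b_def by (auto split: if_splits)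
      ultimately show False using nth_eq_iff_index_eq[OF dist ab(1,2)] ab(3) by simp
    next
      case False
      have old: "adj E x y" if "adj ?E x y" "x \<in> set cs" "y \<in> set cs" for x y
        using that False unfolding adj_def by (auto simp: doubleton_eq_iff)
      have "adj E (last cs) (hd cs)" using cyc old \<open>cs \<noteq> []\<close> unfolding is_cycle_def by simp
      moreover have "adj E (cs ! i) (cs ! Suc i)" if "i < length cs - 1" for i
        using old[OF step[OF that]] that by simp
      ultimately have "is_cycle E cs" using len dist unfolding is_cycle_def by blast
      then show False using tree unfolding is_tree_def by blast
    qed
  qed
  let ?R = "{(x, y). adj ?E x y}\<^sup>*"
  have mono: "{(x, y). adj E x y}\<^sup>* \<subseteq> ?R" by (rule rtrancl_mono) (auto simp: adj_def)
  have uw: "(u, w) \<in> ?R" "(w, u) \<in> ?R"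
    by (rule r_into_rtrancl, simp add: adj_def insert_commute)+
  have "(x, u) \<in> ?R \<and> (u, x) \<in> ?R" if "x \<in> ?V" for x
    using that uw mono tree u unfolding is_tree_def graph_connected_def by blast
  then have "graph_connected ?V ?E"
    unfolding graph_connected_def by (meson rtrancl_trans)
  moreover have "\<exists>a b. a \<in> ?V \<and> b \<in> ?V \<and> a \<noteq> b \<and> e = {a, b}" if "e \<in> ?E" for e
  proof (cases "e = {u, w}")
    case True
    then show ?thesis using u w by blast
  next
    case False
    then have "e \<in> E" using that by blast
    then show ?thesis using tree_edgeE[OF tree] by (metis insertI2)
  qed
  moreover have "finite ?V" using tree unfolding is_tree_def by simp
  ultimately show ?thesis using no_cycle unfolding is_tree_def by blast
qed

lemma card_add_leaf:
  assumes "is_tree V E" "w \<notin> V"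
  shows "card (insert {u, w} E) = Suc (card E)"
  using fresh_edge_notin[OF assms] tree_edges_finite[OF assms(1)] by simp

section \<open>Images of trees under bijections and affine maps\<close>

lemma inj_image_set: "inj f \<Longrightarrow> inj ((`) f)"
  by (rule injI) (simp add: inj_image_eq_iff)

lemma card_image_edges: "bij f \<Longrightarrow> card ((`) f ` E) = card E"
  by (intro card_image inj_on_subset[OF inj_image_set[OF bij_is_inj]]) simp_all

text \<open>A bijection preserves and reflects adjacency; surjectivity onto the whole plane allows
  any cycle of the image to be pulled back.\<close>

lemma is_tree_image:
  assumes tree: "is_tree V E" and f: "bij f"
  shows "is_tree (f ` V) ((`) f ` E)"
proof -
  let ?E = "(`) f ` E"
  have adj: "adj ?E (f x) (f y) \<longleftrightarrow> adj E x y" for x y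
  proof -
    have "f ` {x, y} \<in> ?E \<longleftrightarrow> {x, y} \<in> E"
      by (rule inj_image_mem_iff[OF inj_image_set[OF bij_is_inj[OF f]]])
    then show ?thesis unfolding adj_def by simp
  qed
  have "(f x, f y) \<in> {(x, y). adj ?E x y}\<^sup>*" if "(x, y) \<in> {(x, y). adj E x y}\<^sup>*" for x y
    using that
  proof (induction rule: rtrancl_induct)
    case (step y z)
    then have "(f y, f z) \<in> {(x, y). adj ?E x y}" using adj[of y z] by simp
    with step.IH show ?case by (rule rtrancl_into_rtrancl)
  qed simp
  then have "graph_connected (f ` V) ?E"
    using tree unfolding is_tree_def graph_connected_def by blast
  moreover have "\<not> is_cycle ?E cs" for cs
  proof
    assume cyc: "is_cycle ?E cs"
    obtain ds where ds: "cs = map f ds" using f by (metis bij_is_surj ex_map_conv surj_def)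
    have "ds \<noteq> []" using cyc ds unfolding is_cycle_def by auto
    then have "is_cycle E ds"
      using cyc unfolding ds is_cycle_def
      by (auto simp: adj hd_map last_map distinct_map)
    then show False using tree unfolding is_tree_def by blast
  qed
  moreover have "\<exists>a b. a \<in> f ` V \<and> b \<in> f ` V \<and> a \<noteq> b \<and> e = {a, b}" if e: "e \<in> ?E" for e
  proof -
    obtain e' where e': "e' \<in> E" "e = f ` e'" using e by blast
    obtain u v where uv: "u \<in> V" "v \<in> V" "u \<noteq> v" "e' = {u, v}" by (rule tree_edgeE[OF tree e'(1)])
    have "f u \<noteq> f v" using f uv(3) by (simp add: bij_is_inj inj_eq)
    then show ?thesis using uv e' by (intro exI[of _ "f u"] exI[of _ "f v"]) simp
  qed
  moreover have "finite (f ` V)" using tree unfolding is_tree_def by simp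
  ultimately show ?thesis unfolding is_tree_def by blast
qed

text \<open>Convex hulls commute with linear maps and translations. The instances are the exchange
  of coordinates, a point reflection and a shift.\<close>

lemma affine_facts:
  fixes g :: "point \<Rightarrow> point" and c :: point
  assumes g: "linear g" "inj g" and f: "f = (\<lambda>p. c + g p)"
  shows "bij f" and "edge_seg (f ` e) = f ` edge_seg e"
proof -
  have "bij g" using g linear_injective_imp_surjective[OF g refl] by (simp add: bij_def)
  moreover have "f = (+) c \<circ> g" by (simp add: f comp_def)
  ultimately show "bij f" by (simp add: bij_comp bij_plus_right)
  have "f ` e = (\<lambda>p. c + p) ` g ` e" for e by (simp add: f image_image)
  then show "edge_seg (f ` e) = f ` edge_seg e"
    using g(1) by (simp add: edge_seg_def convex_hull_translation convex_hull_linear_image)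
qed

lemma covers_image:
  assumes "\<And>e. edge_seg (f ` e) = f ` edge_seg e" "covers E P"
  shows "covers ((`) f ` E) (f ` P)"
proof -
  have "(\<Union>e\<in>(`) f ` E. edge_seg e) = f ` (\<Union>e\<in>E. edge_seg e)"
    by (simp add: assms(1) image_UN)
  then show ?thesis using assms(2) unfolding covers_def by (simp only: image_mono)
qed

lemma noncrossing_image:
  assumes seg: "\<And>e. edge_seg (f ` e) = f ` edge_seg e" and f: "inj f" and nc: "noncrossing E"
  shows "noncrossing ((`) f ` E)"
  unfolding noncrossing_def
proof (intro ballI impI)
  fix d1 d2 assume d: "d1 \<in> (`) f ` E" "d2 \<in> (`) f ` E" "d1 \<noteq> d2" "edge_seg d1 \<inter> edge_seg d2 \<noteq> {}"
  then obtain e1 e2 where e: "e1 \<in> E" "e2 \<in> E" "d1 = f ` e1" "d2 = f ` e2" by blast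
  have eq: "edge_seg d1 \<inter> edge_seg d2 = f ` (edge_seg e1 \<inter> edge_seg e2)"
    unfolding e seg using f by (simp add: image_Int)
  then have "e1 \<noteq> e2" "edge_seg e1 \<inter> edge_seg e2 \<noteq> {}" using d e by auto
  then obtain p where p: "p \<in> e1 \<inter> e2" "edge_seg e1 \<inter> edge_seg e2 = {p}"
    using nc e unfolding noncrossing_def by blast
  have "f p \<in> d1 \<inter> d2" using p(1) e by blast
  moreover have "edge_seg d1 \<inter> edge_seg d2 = {f p}" using eq p(2) by simp
  ultimately show "\<exists>p. p \<in> d1 \<inter> d2 \<and> edge_seg d1 \<inter> edge_seg d2 = {p}" by blast
qed

lemma edge_seg_horizontal:
  assumes "a \<le> b"
  shows "edge_seg {(a, y), (b, y)} = {a..b} \<times> {y}"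
proof -
  have "(\<exists>u. 0 \<le> u \<and> u \<le> 1 \<and> x = (1 - u) * a + u * b \<and> z = (1 - u) * y + u * y) \<longleftrightarrow> (a \<le> x \<and> x \<le> b) \<and> z = y" for x z
  proof -
    have "x \<in> closed_segment a b \<longleftrightarrow> a \<le> x \<and> x \<le> b"
      using assms by (simp add: closed_segment_eq_real_ivl)
    then show ?thesis unfolding in_segment by (auto simp: algebra_simps)
  qed
  then show ?thesis unfolding edge_seg_doubleton by (auto simp: in_segment)
qed

lemma edge_seg_vertical:
  assumes "a \<le> b"
  shows "edge_seg {(x, a), (x, b)} = {x} \<times> {a..b}"
proof -
  have swap: "edge_seg (prod.swap ` e) = prod.swap ` edge_seg e" for e
    by (rule affine_facts(2)[of prod.swap _ 0]) (auto simp: linear_iff inj_def)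
  have "edge_seg {(x, a), (x, b)} = prod.swap ` edge_seg {(a, x), (b, x)}" by (simp flip: swap)
  then show ?thesis by (simp only: edge_seg_horizontal[OF assms] product_swap)
qed

subsection \<open>Combs and spirals\<close>

text \<open>Starting at abscissa 0, left of the grid, keeps the tooth nondegenerate even for n =
  1.\<close>

definition tooth :: "nat \<Rightarrow> nat \<Rightarrow> point set" where
  "tooth n j = {(0, real j), (real n, real j)}"

definition spine :: "nat \<Rightarrow> point set" where
  "spine j = {(0, real j), (0, real (Suc j))}"

definition comb :: "nat \<Rightarrow> nat \<Rightarrow> point set set" where
  "comb n m = tooth n ` {1..m} \<union> spine ` {1..<m}"

text \<open>Each further row adds two leaves in turn: the next spine vertex, and then the right end
  of the tooth.\<close>

lemma comb_tree:
  assumes "1 \<le> n" "1 \<le> m"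
  shows "is_tree ({0, real n} \<times> real ` {1..m}) (comb n m) \<and> card (comb n m) = 2 * m - 1"
  using assms(2)
proof (induction m rule: dec_induct)
  case base
  have "is_tree {(real n, 1), (0, 1)} {{(0, 1), (real n, 1)}}"
    using is_tree_add_leaf[OF is_tree_singleton, of "(0, 1)" "(0, 1)" "(real n, 1)"] assms by simp
  moreover have "{(real n, 1), (0, 1)} = {0, real n} \<times> real ` {1..1}" by auto
  ultimately show ?case by (simp add: comb_def tooth_def)
next
  case (step m)
  let ?V = "\<lambda>m. {0, real n} \<times> real ` {1..m}"
  let ?w = "(0, real (Suc m))" and ?w' = "(real n, real (Suc m))"
  have tree: "is_tree (?V m) (comb n m)" using step by blast
  have w: "?w \<notin> ?V m" "(0, real m) \<in> ?V m" "?w' \<notin> insert ?w (?V m)"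
    using step(1) assms by auto
  note t1 = is_tree_add_leaf[OF tree w(2,1)]
  have t2: "is_tree (insert ?w' (insert ?w (?V m))) (insert {?w, ?w'} (insert {(0, real m), ?w} (comb n m)))"
    by (rule is_tree_add_leaf[OF t1 _ w(3)]) simp
  have card: "card (insert {?w, ?w'} (insert {(0, real m), ?w} (comb n m))) = Suc (Suc (card (comb n m)))"
    using card_add_leaf[OF t1 w(3)] card_add_leaf[OF tree w(1)] by simp
  have "insert ?w' (insert ?w (?V m)) = ?V (Suc m)"
    by (auto simp: atLeastAtMostSuc_conv)
  moreover have "insert {?w, ?w'} (insert {(0, real m), ?w} (comb n m)) = comb n (Suc m)"
    using step(1) by (auto simp: comb_def tooth_def spine_def atLeastAtMostSuc_conv atLeastLessThanSuc)
  ultimately show ?case using t2 card step by simp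
qed

lemma seg_tooth: "edge_seg (tooth n j) = {0..real n} \<times> {real j}"
  unfolding tooth_def by (rule edge_seg_horizontal) simp

lemma seg_spine: "edge_seg (spine j) = {0} \<times> {real j..real (Suc j)}"
  unfolding spine_def by (rule edge_seg_vertical) simp

lemma comb_covers: "covers (comb n m) (grid n m)"
  unfolding covers_def
proof
  fix p assume "p \<in> grid n m"
  then obtain i j where p: "p = (real i, real j)" "i \<le> n" "1 \<le> j" "j \<le> m" unfolding grid_def by blast
  then have "p \<in> edge_seg (tooth n j)" by (simp add: seg_tooth)
  moreover have "tooth n j \<in> comb n m" using p by (simp add: comb_def)
  ultimately show "p \<in> \<Union> (edge_seg ` comb n m)" by blast
qed

text \<open>Teeth lie at integer heights and spine edges join consecutive integer heights, so two
  edges can meet only in a common endpoint.\<close>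

lemma comb_noncrossing: "noncrossing (comb n m)"
proof -
  let ?Q = "\<lambda>e1 e2. \<exists>p. p \<in> e1 \<inter> e2 \<and> edge_seg e1 \<inter> edge_seg e2 = {p}"
  have sym: "?Q e2 e1" if "?Q e1 e2" for e1 e2 using that by (simp add: Int_commute)
  have tt: "edge_seg (tooth n j) \<inter> edge_seg (tooth n k) = {}" if "j \<noteq> k" for j k
    using that by (auto simp: seg_tooth)
  have ts: "?Q (tooth n j) (spine k)" if "edge_seg (tooth n j) \<inter> edge_seg (spine k) \<noteq> {}" for j k
  proof -
    have "real k \<le> real j" "real j \<le> real (Suc k)" using that by (auto simp: seg_tooth seg_spine)
    then have "j = k \<or> j = Suc k" by linarith
    then have "(0, real j) \<in> tooth n j \<inter> spine k" by (auto simp: tooth_def spine_def)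
    moreover have "edge_seg (tooth n j) \<inter> edge_seg (spine k) = {(0, real j)}"
      using \<open>j = k \<or> j = Suc k\<close> by (auto simp: seg_tooth seg_spine)
    ultimately show ?thesis by blast
  qed
  have ss: "?Q (spine j) (spine k)" if "edge_seg (spine j) \<inter> edge_seg (spine k) \<noteq> {}" "j < k" for j k
  proof -
    have "real k \<le> real (Suc j)" using that by (auto simp: seg_spine)
    then have "k = Suc j" using that(2) by linarith
    then have "(0, real k) \<in> spine j \<inter> spine k" by (auto simp: spine_def)
    moreover have "edge_seg (spine j) \<inter> edge_seg (spine k) = {(0, real k)}"
      using \<open>k = Suc j\<close> by (auto simp: seg_spine)
    ultimately show ?thesis by blast
  qed
  show ?thesis unfolding noncrossing_def
  proof (intro ballI impI)
    fix e1 e2 assume e: "e1 \<in> comb n m" "e2 \<in> comb n m" and ne: "e1 \<noteq> e2"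
      and meet: "edge_seg e1 \<inter> edge_seg e2 \<noteq> {}"
    have meet': "edge_seg e2 \<inter> edge_seg e1 \<noteq> {}" using meet by (simp add: Int_commute)
    consider j k where "e1 = tooth n j" "e2 = tooth n k" | j k where "e1 = tooth n j" "e2 = spine k"
      | j k where "e1 = spine k" "e2 = tooth n j" | j k where "e1 = spine j" "e2 = spine k"
      using e unfolding comb_def by blast
    then show "?Q e1 e2"
    proof cases
      case 1
      then show ?thesis using tt[of j k] meet ne by auto
    next
      case 2
      then show ?thesis using ts[of j k] meet by blast
    next
      case 3
      then show ?thesis using sym[OF ts[of j k]] meet' by blast
    next
      case 4
      then have "j < k \<or> k < j" using ne by (metis linorder_neqE_nat)
      then show ?thesis using 4 ss[of j k] sym[OF ss[of k j]] meet meet' by blast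
    qed
  qed
qed

text \<open>If there are more rows than columns, the comb is built with the coordinates
  exchanged.\<close>

lemma exists_noncrossing_covering_tree:
  assumes "1 \<le> n" "1 \<le> m"
  shows "\<exists>V E. geometric_tree V E \<and> noncrossing E \<and> covers E (grid n m) \<and> card E = 2 * min n m - 1"
proof (cases "m \<le> n")
  case True
  have "comb n m \<noteq> {}" using assms by (simp add: comb_def)
  then show ?thesis
    using comb_tree[OF assms] comb_covers[of n m] comb_noncrossing[of n m] True
    unfolding geometric_tree_def by (auto simp: min_def)
next
  case False
  let ?E = "(`) prod.swap ` comb m n"
  have g: "linear (prod.swap :: point \<Rightarrow> point)" "inj (prod.swap :: point \<Rightarrow> point)"
    by (auto simp: linear_iff)
  have "(prod.swap :: point \<Rightarrow> point) = (\<lambda>p. 0 + prod.swap p)" by simp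
  note facts = affine_facts[OF g this]
  have "card ?E = card (comb m n)"
    by (rule card_image_edges[OF facts(1)])
  then have "card ?E = 2 * min n m - 1" using comb_tree[OF assms(2,1)] False by simp
  moreover have "prod.swap ` grid m n = grid n m" unfolding grid_def by force
  then have "covers ?E (grid n m)" using covers_image[OF facts(2) comb_covers[of m n]] by simp
  moreover have "noncrossing ?E" by (rule noncrossing_image[OF facts(2) g(2) comb_noncrossing])
  moreover have "is_tree (prod.swap ` ({0, real m} \<times> real ` {1..n})) ?E"
    by (rule is_tree_image[OF _ facts(1)]) (use comb_tree[OF assms(2,1)] in blast)
  moreover have "?E \<noteq> {}" using assms by (simp add: comb_def)
  ultimately show ?thesis unfolding geometric_tree_def by blast
qed

section \<open>The spiral for squares\<close>

text \<open>The square grid with its lower left corner moved to the origin;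
  \<open>exists_square_covering_tree\<close> shifts it back by (1, 1).\<close>

definition block :: "nat \<Rightarrow> point set" where
  "block n = {(real i, real j) | i j. i < n \<and> j < n}"

text \<open>The tree grows in a spiral: \<open>(-1, 0)\<close> is the vertex from which the next column can be
  drawn, and the next row continues from the end of that column. Reflecting in the centre of the
  enlarged block restores this position.\<close>

definition spiral_tree :: "nat \<Rightarrow> point set \<Rightarrow> point set set \<Rightarrow> bool" where
  "spiral_tree n V E \<longleftrightarrow> is_tree V E \<and> card E + 2 = 2 * n \<and> covers E (block n) \<and> (-1, 0) \<in> V \<and>
     (\<forall>p\<in>V. 0 \<le> snd p \<and> snd p \<le> real n) \<and> (-1, real n) \<notin> V \<and> (real n, real n) \<notin> V"

lemma edge_seg_diagonal:
  fixes a b :: point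
  assumes "0 \<le> u" "u \<le> 1" "x = (1 - u) * fst a + u * fst b" "y = (1 - u) * snd a + u * snd b"
  shows "(x, y) \<in> edge_seg {a, b}"
  using assms unfolding edge_seg_doubleton in_segment
  by (intro exI[of _ u]) (simp add: prod_eq_iff)

text \<open>The nine dots path \<open>?p0\<close>, ..., \<open>?p4\<close>: the diagonal, the left
  column prolonged to height 3, the line x + y = 3 and the bottom row. The last edge overshoots to
  (-1, 0), from which the spiral continues.\<close>

lemma spiral_tree_3: "\<exists>V E. spiral_tree 3 V E"
proof -
  let ?p0 = "(2, 2) :: point" and ?p1 = "(0, 0) :: point" and ?p2 = "(0, 3) :: point"
    and ?p3 = "(3, 0) :: point" and ?p4 = "(-1, 0) :: point"
  let ?V = "{?p4, ?p3, ?p2, ?p1, ?p0}" and ?E = "{{?p3, ?p4}, {?p2, ?p3}, {?p1, ?p2}, {?p0, ?p1}}"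
  have t1: "is_tree {?p1, ?p0} {{?p0, ?p1}}" by (rule is_tree_add_leaf[OF is_tree_singleton]) auto
  have t2: "is_tree {?p2, ?p1, ?p0} {{?p1, ?p2}, {?p0, ?p1}}" by (rule is_tree_add_leaf[OF t1]) auto
  have t3: "is_tree {?p3, ?p2, ?p1, ?p0} {{?p2, ?p3}, {?p1, ?p2}, {?p0, ?p1}}"
    by (rule is_tree_add_leaf[OF t2]) auto
  have t4: "is_tree ?V ?E" by (rule is_tree_add_leaf[OF t3]) auto
  have card: "card ?E = 4" by (simp add: doubleton_eq_iff)
  have h: "edge_seg {?p3, ?p4} = {-1..3} \<times> {0}"
    using edge_seg_horizontal[of "-1" 3 0] by (simp add: insert_commute)
  have v: "edge_seg {?p1, ?p2} = {0} \<times> {0..3}" using edge_seg_vertical[of 0 3 0] by simp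
  have d: "(1, 1) \<in> edge_seg {?p0, ?p1}" "(2, 2) \<in> edge_seg {?p0, ?p1}"
    "(1, 2) \<in> edge_seg {?p2, ?p3}" "(2, 1) \<in> edge_seg {?p2, ?p3}"
    by (rule edge_seg_diagonal[of "1/2"] edge_seg_diagonal[of 0] edge_seg_diagonal[of "1/3"]
        edge_seg_diagonal[of "2/3"]; simp)+
  have "covers ?E (block 3)"
    unfolding covers_def
  proof
    fix p assume "p \<in> block 3"
    then obtain i j where p: "p = (real i, real j)" and "i < 3" "j < 3" unfolding block_def by blast
    then have "i = 0 \<or> i = 1 \<or> i = 2" "j = 0 \<or> j = 1 \<or> j = 2" by auto
    then show "p \<in> \<Union> (edge_seg ` ?E)" using d unfolding p by (auto simp: h v)
  qed
  then have "spiral_tree 3 ?V ?E" unfolding spiral_tree_def using t4 card by simp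
  then show ?thesis by blast
qed

text \<open>The edges from \<open>?c\<close> via \<open>?a\<close> to \<open>?b\<close> cover a new
  column at abscissa -1 and a new row at height n. The reflection \<open>f\<close> maps the enlarged
  block onto \<open>block (Suc n)\<close> and \<open>?b\<close> to (-1, 0).\<close>

lemma spiral_tree_Suc:
  assumes "spiral_tree n V E"
  shows "\<exists>V' E'. spiral_tree (Suc n) V' E'"
proof -
  let ?c = "(-1, 0) :: point" and ?a = "(-1, real n) :: point" and ?b = "(real n, real n) :: point"
  have tree: "is_tree V E" and card: "card E + 2 = 2 * n" and cov: "covers E (block n)"
    and c: "?c \<in> V" and range: "\<And>p. p \<in> V \<Longrightarrow> 0 \<le> snd p \<and> snd p \<le> real n"
    and a: "?a \<notin> V" and b: "?b \<notin> V"
    using assms unfolding spiral_tree_def by blast+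
  let ?V = "insert ?b (insert ?a V)" and ?E = "insert {?a, ?b} (insert {?c, ?a} E)"
  have b': "?b \<notin> insert ?a V" using b by simp
  have t1: "is_tree (insert ?a V) (insert {?c, ?a} E)" by (rule is_tree_add_leaf[OF tree c a])
  have t2: "is_tree ?V ?E" by (rule is_tree_add_leaf[OF t1 _ b']) simp
  have card2: "card ?E = Suc (Suc (card E))"
    using card_add_leaf[OF t1 b'] card_add_leaf[OF tree a] by simp
  define f where "f = (\<lambda>p :: point. (real n - 1, real n) + (- p))"
  have g: "linear (uminus :: point \<Rightarrow> point)" "inj (uminus :: point \<Rightarrow> point)"
    by (auto simp: linear_iff)
  note facts = affine_facts[OF g f_def]
  have inv: "f (f p) = p" for p unfolding f_def by simp
  have f_Pair: "f (x, y) = (real n - 1 - x, real n - y)" for x y unfolding f_def by simp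
  have "block (Suc n) \<subseteq> f ` (\<Union>e\<in>?E. edge_seg e)"
  proof
    fix p assume "p \<in> block (Suc n)"
    then obtain i j where p: "p = (real i, real j)" and ij: "i \<le> n" "j \<le> n" unfolding block_def by auto
    have "f p \<in> (\<Union>e\<in>?E. edge_seg e)"
    \<comment> \<open>These are the points that \<open>f\<close> sends to the new column or the new
      row; all others land in the old block.\<close>
    proof (cases "i = n \<or> j = 0")
      case True
      then show ?thesis
        using ij edge_seg_vertical[of 0 "real n" "-1"] edge_seg_horizontal[of "-1" "real n" "real n"]
        unfolding p f_Pair by auto
    next
      case False
      then have "f p = (real (n - 1 - i), real (n - j))" using ij unfolding p f_Pair by auto
      moreover have "n - 1 - i < n" "n - j < n" using False ij by auto
      ultimately have "f p \<in> block n" unfolding block_def by blast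
      then show ?thesis using cov unfolding covers_def by blast
    qed
    then show "p \<in> f ` (\<Union>e\<in>?E. edge_seg e)" by (metis image_eqI inv)
  qed
  then have covers: "covers ((`) f ` ?E) (block (Suc n))"
    unfolding covers_def image_UN facts(2)[symmetric] by simp
  have cardf: "card ((`) f ` ?E) + 2 = 2 * Suc n"
    unfolding card_image_edges[OF facts(1)] card2 using card by simp
  have "(-1, 0) = f ?b" by (simp add: f_Pair)
  then have start: "(-1, 0) \<in> f ` ?V" by (rule image_eqI) simp
  have range': "0 \<le> snd q \<and> snd q \<le> real n" if "q \<in> f ` ?V" for q
  proof -
    from that obtain p where p: "q = f p" "p \<in> ?V" by (rule imageE)
    from p(2) have "p = ?b \<or> p = ?a \<or> p \<in> V" by simp
    then have "0 \<le> snd p \<and> snd p \<le> real n" by (elim disjE) (simp_all add: range)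
    then show ?thesis unfolding p(1) f_def by simp
  qed
  have range'': "\<forall>q\<in>f ` ?V. 0 \<le> snd q \<and> snd q \<le> real (Suc n)"
  proof
    fix q assume "q \<in> f ` ?V"
    from range'[OF this] show "0 \<le> snd q \<and> snd q \<le> real (Suc n)" by simp
  qed
  \<comment> \<open>The reflected tree stays at heights at most n, so both vertices of the next
    step, at height n + 1, are new.\<close>
  have fresh: "(x, real (Suc n)) \<notin> f ` ?V" for x
  proof
    assume "(x, real (Suc n)) \<in> f ` ?V"
    from range'[OF this] show False by simp
  qed
  have "spiral_tree (Suc n) (f ` ?V) ((`) f ` ?E)"
    unfolding spiral_tree_def
    by (intro conjI is_tree_image[OF t2 facts(1)] covers cardf start range'' fresh)
  then show ?thesis by blast
qed

lemma exists_square_covering_tree: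
  assumes "3 \<le> n"
  shows "\<exists>V E. geometric_tree V E \<and> covers E (grid n n) \<and> card E = 2 * n - 2"
proof -
  have "\<exists>V E. spiral_tree n V E"
    using assms by (induction n rule: dec_induct) (use spiral_tree_3 spiral_tree_Suc in blast)+
  then obtain V E where s: "is_tree V E" "card E + 2 = 2 * n" "covers E (block n)"
    unfolding spiral_tree_def by blast
  define f where "f = (\<lambda>p :: point. (1, 1) + id p)"
  note facts = affine_facts[OF linear_id inj_on_id f_def]
  have "grid n n \<subseteq> f ` block n"
  proof
    fix p assume "p \<in> grid n n"
    then obtain i j where p: "p = (real i, real j)" and ij: "1 \<le> i" "i \<le> n" "1 \<le> j" "j \<le> n"
      unfolding grid_def by blast
    have "p = f (real (i - 1), real (j - 1))" using ij unfolding p f_def by simp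
    moreover have "(real (i - 1), real (j - 1)) \<in> block n"
      unfolding block_def by (intro CollectI exI[of _ "i - 1"] exI[of _ "j - 1"]) (use ij in auto)
    ultimately show "p \<in> f ` block n" by (rule image_eqI)
  qed
  then have "covers ((`) f ` E) (grid n n)"
    using covers_image[OF facts(2) s(3)] unfolding covers_def by (rule subset_trans)
  moreover have "card ((`) f ` E) = 2 * n - 2"
    unfolding card_image_edges[OF facts(1)] using s(2) by simp
  moreover have "E \<noteq> {}" using s(2) assms by auto
  then have "geometric_tree (f ` V) ((`) f ` E)"
    using is_tree_image[OF s(1) facts(1)] unfolding geometric_tree_def by simp
  ultimately show ?thesis by blast
qed

theorem theorem4:
  fixes n m :: nat
  assumes "n \<ge> 1" and "m \<ge> 1"
  shows "is_minimum {card E | V E. geometric_tree V E \<and> covers E (grid n m)}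
           (if n = m \<and> n \<ge> 3 then 2 * min n m - 2 else 2 * min n m - 1)
       \<and> is_minimum {card E | V E. geometric_tree V E \<and> noncrossing E \<and> covers E (grid n m)}
           (2 * min n m - 1)"
proof
  obtain V E where T: "geometric_tree V E" "noncrossing E" "covers E (grid n m)" "card E = 2 * min n m - 1"
    using exists_noncrossing_covering_tree[OF assms] by blast
  show "is_minimum {card E | V E. geometric_tree V E \<and> noncrossing E \<and> covers E (grid n m)} (2 * min n m - 1)"
    unfolding is_minimum_def
  proof
    show "2 * min n m - 1 \<in> {card E | V E. geometric_tree V E \<and> noncrossing E \<and> covers E (grid n m)}"
      using T by force
    show "\<forall>x\<in>{card E | V E. geometric_tree V E \<and> noncrossing E \<and> covers E (grid n m)}. 2 * min n m - 1 \<le> x"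
      using noncrossing_covering_tree_card by blast
  qed
  show "is_minimum {card E | V E. geometric_tree V E \<and> covers E (grid n m)}
      (if n = m \<and> n \<ge> 3 then 2 * min n m - 2 else 2 * min n m - 1)"
  proof (cases "n = m \<and> n \<ge> 3")
    case True
    then obtain V' E' where "geometric_tree V' E'" "covers E' (grid n m)" "card E' = 2 * min n m - 2"
      using exists_square_covering_tree[of n] by auto
    then have "2 * min n m - 2 \<in> {card E | V E. geometric_tree V E \<and> covers E (grid n m)}" by force
    moreover have "2 * min n m - 2 \<le> card E'" if "geometric_tree V' E'" "covers E' (grid n m)" for V' E'
    proof (rule ccontr)
      assume "\<not> ?thesis"
      \<comment> \<open>\<open>covering_tree_card\<close> would yield exactly 2n - 2 edges, which
        contradicts having fewer.\<close>
      then have "card E' + 2 \<le> 2 * min n m" "card E' + 2 \<noteq> 2 * n" using True by auto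
      then show False using covering_tree_card[OF that] by blast
    qed
    ultimately show ?thesis unfolding is_minimum_def using True by auto
  next
    case False
    have "2 * min n m - 1 \<in> {card E | V E. geometric_tree V E \<and> covers E (grid n m)}"
      using T by force
    moreover have "2 * min n m - 1 \<le> card E'" if "geometric_tree V' E'" "covers E' (grid n m)" for V' E'
      by (rule covering_tree_card_unless_square[OF that False])
    ultimately show ?thesis unfolding is_minimum_def using False by auto
  qed
qed

end
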